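(* The subspace of $\textsf{ParSym}$ spanned by $\{\textsf{H}_\pi : \pi \text{ a matching}\}$ is a Hopf subalgebra of $\textsf{ParSym}$: it contains $\textsf{H}_\varnothing$, is closed under the product, $\Delta$ maps it into its tensor square, and the antipode $S$ maps it into itself.
   Context: Partition diagrams of order $k$ are set partitions of $\{1,\ldots,k,1',\ldots,k'\}$; $A_0=\{\varnothing\}$. A matching is a partition diagram all of whose blocks have size at most two. For $\pi$ of order $k$, $\rho$ of order $l$: $\pi\otimes\rho$ has as blocks those of $\pi$ and those of $\rho$ shifted ($i\mapsto i+k$, $i'\mapsto(i+k)'$). A diagram is $\otimes$-irreducible if it is not $\rho^{(1)}\otimes\rho^{(2)}$ with both factors nonempty. For nonempty $\pi,\rho$ (orders $k,l$), $\pi\bullet\rho$ is obtained from $\pi\otimes\rho$ by merging the block containing $k'$ with the block containing $(k+1)'$; $\varnothing\bullet\rho=\rho$, $\pi\bullet\varnothing=\pi$. Over a field $\mathbbm{k}$, $\textsf{ParSym}$ has basis $\{\textsf{H}_\pi\}$ over all partition diagrams, product $\textsf{H}_\pi\textsf{H}_\rho=\textsf{H}_{\pi\otimes\rho}$, unit $\textsf{H}_\varnothing$ (free on $\textsf{H}_\pi$, $\pi$ nonempty $\otimes$-irreducible). $\Delta$ is the algebra morphism with $\Delta\textsf{H}_\varnothing=\textsf{H}_\varnothing\otimes\textsf{H}_\varnothing$ and $\Delta\textsf{H}_\pi=\sum\textsf{H}_{G_1}\otimes\textsf{H}_{G_2}$ for nonempty $\otimes$-irreducible $\pi$, over ordered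 pairs $(G_1,G_2)$, each $\varnothing$ or $\otimes$-irreducible, with $G_1\bullet G_2=\pi$. $S$ is the linear antimorphism with $S(\textsf{H}_\varnothing)=\textsf{H}_\varnothing$ and $S(\textsf{H}_\pi)=\sum(-1)^\ell\textsf{H}_{\rho^{(1)}}\cdots\textsf{H}_{\rho^{(\ell)}}$ for nonempty $\otimes$-irreducible $\pi$, over tuples of nonempty diagrams with $\rho^{(1)}\bullet\cdots\bullet\rho^{(\ell)}=\pi$. *)

theory Defs
  imports
    Complex_Main
    "HOL-Library.Disjoint_Sets"
    "HOL-Library.Poly_Mapping"
    "HOL-Library.Product_Plus"
begin

section \<open>Partition diagrams\<close>

text \<open>The vertex \<open>i\<close> is encoded as \<open>Inl i\<close> and the vertex \<open>i'\<close> as \<open>Inr i\<close>.\<close>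

definition vertices :: "nat \<Rightarrow> (nat + nat) set" where
  "vertices k = {1..k} <+> {1..k}"

lemma vertices_0 [simp]: "vertices 0 = {}"
  by (auto simp: vertices_def)

text \<open>The order is recorded explicitly as the first component of a diagram.\<close>

typedef pdiag = "{(k, P). partition_on (vertices k) P}"
  by (rule exI[of _ "(0, {})"]) (auto simp: vertices_def partition_on_def)

setup_lifting type_definition_pdiag

lift_definition diag_order :: "pdiag \<Rightarrow> nat" is fst .

lift_definition blocks :: "pdiag \<Rightarrow> (nat + nat) set set" is snd .

lift_definition empty_diag :: pdiag is "(0, {})"
  by (auto simp: vertices_def partition_on_def)

definition matching :: "pdiag \<Rightarrow> bool" where
  "matching \<pi> \<longleftrightarrow> (\<forall>B \<in> blocks \<pi>. card B \<le> 2)"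

definition shift :: "nat \<Rightarrow> nat + nat \<Rightarrow> nat + nat" where
  "shift k = map_sum (\<lambda>i. i + k) (\<lambda>i. i + k)"

lemma inj_shift: "inj (shift k)"
  unfolding shift_def by (intro sum.inj_map) (auto simp: inj_on_def)

lemma shift_image_eq_iff [simp]: "shift k ` X = shift k ` Y \<longleftrightarrow> X = Y"
  by (rule inj_image_eq_iff[OF inj_shift])

lemma shift_add: "shift k ` shift l ` X = shift (k + l) ` X"
proof -
  have "shift k (shift l x) = shift (k + l) x" for x
    by (cases x) (auto simp: shift_def)
  then show ?thesis by (simp add: image_image)
qed

lemma shift_add_image: "(`) (shift k) ` (`) (shift l) ` P = (`) (shift (k + l)) ` P"
proof -
  have "(`) (shift k) \<circ> (`) (shift l) = (`) (shift (k + l))"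
    by (rule ext) (simp only: o_apply shift_add)
  then show ?thesis by (simp only: image_comp)
qed

lemma shift_vertices: "shift k ` vertices l = vertices (k + l) - vertices k"
proof (intro set_eqI iffI)
  fix x assume "x \<in> vertices (k + l) - vertices k"
  then show "x \<in> shift k ` vertices l"
    by (intro image_eqI[of _ _ "map_sum (\<lambda>i. i - k) (\<lambda>i. i - k) x"])
      (cases x; auto simp: shift_def vertices_def)+
qed (auto simp: shift_def vertices_def)

lemma vertices_mono: "k \<le> l \<Longrightarrow> vertices k \<subseteq> vertices l"
  by (auto simp: vertices_def)

lemma finite_vertices: "finite (vertices k)"
  by (simp add: vertices_def)

lemma partition_on_tensor:
  assumes P: "partition_on (vertices k) P" and Q: "partition_on (vertices l) Q"
  shows "partition_on (vertices (k + l)) (P \<union> (`) (shift k) ` Q)"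
proof -
  have "inj_on (shift k) (vertices l)"
    using inj_shift by (rule inj_on_subset) auto
  from partition_on_inj_image[OF Q this]
  have Q': "partition_on (vertices (k + l) - vertices k) ((`) (shift k) ` Q)"
    using partition_onD3[OF Q] by (simp add: shift_vertices image_iff)
  have un: "vertices k \<union> (vertices (k + l) - vertices k) = vertices (k + l)"
    using vertices_mono[of k "k + l"] by auto
  show ?thesis
  proof (rule partition_onI)
    show "\<Union> (P \<union> (`) (shift k) ` Q) = vertices (k + l)"
      using partition_onD1[OF P] partition_onD1[OF Q'] un by (simp only: Union_Un_distrib)
    show "{} \<notin> P \<union> (`) (shift k) ` Q"
      using partition_onD3[OF P] partition_onD3[OF Q'] by (simp only: Un_iff not_False_eq_True simp_thms)
    fix X Y assume XY: "X \<in> P \<union> (`) (shift k) ` Q" "Y \<in> P \<union> (`) (shift k) ` Q" "X \<noteq> Y"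
    have 1: "disjnt A B" if "A \<in> P" "B \<in> (`) (shift k) ` Q" for A B
    proof -
      have "A \<subseteq> vertices k"
        unfolding partition_onD1[OF P] by (rule Union_upper) (rule that(1))
      moreover have "B \<subseteq> vertices (k + l) - vertices k"
        unfolding partition_onD1[OF Q'] by (rule Union_upper) (rule that(2))
      ultimately show ?thesis unfolding disjnt_def by blast
    qed
    have 2: "disjnt A B" if "A \<in> P" "B \<in> P" "A \<noteq> B" for A B
      by (rule pairwiseD[OF partition_onD2[OF P] that])
    have 3: "disjnt A B" if "A \<in> (`) (shift k) ` Q" "B \<in> (`) (shift k) ` Q" "A \<noteq> B" for A B
      by (rule pairwiseD[OF partition_onD2[OF Q'] that])
    show "disjnt X Y"
      using XY(1,2)
    proof (elim UnE)
      assume "X \<in> P" "Y \<in> (`) (shift k) ` Q"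
      then show ?thesis by (rule 1)
    next
      assume "X \<in> (`) (shift k) ` Q" "Y \<in> P"
      then show ?thesis by (intro disjnt_sym[OF 1])
    next
      assume "X \<in> P" "Y \<in> P"
      then show ?thesis using XY(3) by (rule 2)
    next
      assume "X \<in> (`) (shift k) ` Q" "Y \<in> (`) (shift k) ` Q"
      then show ?thesis using XY(3) by (rule 3)
    qed
  qed
qed

lift_definition tensor_diag :: "pdiag \<Rightarrow> pdiag \<Rightarrow> pdiag" (infixr \<open>\<otimes>\<close> 70)
  is "\<lambda>(k, P) (l, Q). (k + l, P \<union> (`) (shift k) ` Q)"
  using partition_on_tensor by auto

definition merge_blocks :: "'a \<Rightarrow> 'a \<Rightarrow> 'a set set \<Rightarrow> 'a set set" where
  "merge_blocks x y P =
     {B \<in> P. x \<notin> B \<and> y \<notin> B} \<union> {\<Union>{B \<in> P. x \<in> B \<or> y \<in> B}}"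

lemma partition_on_merge_blocks:
  assumes P: "partition_on A P" and x: "x \<in> A"
  shows "partition_on A (merge_blocks x y P)"
proof (rule partition_onI)
  show "\<Union> (merge_blocks x y P) = A"
    using P by (auto simp: merge_blocks_def partition_on_def)
  show "{} \<notin> merge_blocks x y P"
    using P x by (auto simp: merge_blocks_def partition_on_def)
  fix X Y assume XY: "X \<in> merge_blocks x y P" "Y \<in> merge_blocks x y P" "X \<noteq> Y"
  have *: "disjnt B C" if "B \<in> P" "C \<in> P" "B \<noteq> C" for B C
    using that P by (auto simp: partition_on_def pairwise_def)
  have **: "disjnt B (\<Union>{C \<in> P. x \<in> C \<or> y \<in> C})" if "B \<in> P" "x \<notin> B" "y \<notin> B" for B
    unfolding disjnt_Union2 using that * by blast
  consider "X \<in> P" "Y \<in> P" | "X \<in> P" "x \<notin> X" "y \<notin> X" "Y = \<Union>{C \<in> P. x \<in> C \<or> y \<in> C}"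
    | "Y \<in> P" "x \<notin> Y" "y \<notin> Y" "X = \<Union>{C \<in> P. x \<in> C \<or> y \<in> C}"
    using XY unfolding merge_blocks_def by blast
  then show "disjnt X Y"
  proof cases
    case 3
    then show ?thesis using disjnt_sym[OF **[of Y]] by simp
  qed (use * ** XY(3) in simp_all)
qed

lemma Inr_in_vertices: "0 < k \<Longrightarrow> Inr k \<in> vertices (k + l)"
  by (auto simp: vertices_def)

lift_definition bullet :: "pdiag \<Rightarrow> pdiag \<Rightarrow> pdiag" (infixr \<open>\<bullet>\<close> 70)
  is "\<lambda>(k, P) (l, Q).
    if k = 0 then (l, Q) else if l = 0 then (k, P)
    else (k + l, merge_blocks (Inr k) (Inr (k + 1)) (P \<union> (`) (shift k) ` Q))"
  by (auto intro!: partition_on_merge_blocks partition_on_tensor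
    simp: Inr_in_vertices split: if_splits)

definition tensor_irreducible :: "pdiag \<Rightarrow> bool" where
  "tensor_irreducible \<pi> \<longleftrightarrow>
     \<not> (\<exists>\<rho>1 \<rho>2. \<rho>1 \<noteq> empty_diag \<and> \<rho>2 \<noteq> empty_diag \<and> \<pi> = \<rho>1 \<otimes> \<rho>2)"

lemma partition_on_blocks: "partition_on (vertices (diag_order \<pi>)) (blocks \<pi>)"
  by transfer auto

lemma pdiag_eqI: "diag_order \<pi> = diag_order \<rho> \<Longrightarrow> blocks \<pi> = blocks \<rho> \<Longrightarrow> \<pi> = \<rho>"
  by transfer auto

lemma diag_order_empty [simp]: "diag_order empty_diag = 0"
  by transfer simp

lemma blocks_empty [simp]: "blocks empty_diag = {}"
  by transfer simp

lemma diag_order_0_iff [simp]: "diag_order \<pi> = 0 \<longleftrightarrow> \<pi> = empty_diag"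
proof
  assume "diag_order \<pi> = 0"
  then have "partition_on {} (blocks \<pi>)" using partition_on_blocks[of \<pi>] by simp
  then have "blocks \<pi> = {}" by (simp add: partition_on_empty)
  with \<open>diag_order \<pi> = 0\<close> show "\<pi> = empty_diag" by (intro pdiag_eqI) auto
qed simp

lemma diag_order_pos_iff [simp]: "0 < diag_order \<pi> \<longleftrightarrow> \<pi> \<noteq> empty_diag"
  using diag_order_0_iff[of \<pi>] by linarith

lemma diag_order_tensor [simp]: "diag_order (\<pi> \<otimes> \<rho>) = diag_order \<pi> + diag_order \<rho>"
  by transfer auto

lemma blocks_tensor: "blocks (\<pi> \<otimes> \<rho>) = blocks \<pi> \<union> (`) (shift (diag_order \<pi>)) ` blocks \<rho>"
  by transfer auto

lemma bullet_empty_left [simp]: "empty_diag \<bullet> \<rho> = \<rho>"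
  by transfer auto

lemma bullet_empty_right [simp]: "\<pi> \<bullet> empty_diag = \<pi>"
  by transfer (auto simp: partition_on_empty)

lemma diag_order_bullet [simp]: "diag_order (\<pi> \<bullet> \<rho>) = diag_order \<pi> + diag_order \<rho>"
  by transfer auto

lemma blocks_bullet:
  "\<pi> \<noteq> empty_diag \<Longrightarrow> \<rho> \<noteq> empty_diag \<Longrightarrow> blocks (\<pi> \<bullet> \<rho>) =
     merge_blocks (Inr (diag_order \<pi>)) (Inr (diag_order \<pi> + 1)) (blocks (\<pi> \<otimes> \<rho>))"
  unfolding diag_order_0_iff[symmetric] by transfer auto

lemma finite_pdiag_order: "finite {\<pi>. diag_order \<pi> = n}"
proof (rule finite_imageD)
  have "blocks ` {\<pi>. diag_order \<pi> = n} \<subseteq> {P. partition_on (vertices n) P}"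
    using partition_on_blocks by auto
  then show "finite (blocks ` {\<pi>. diag_order \<pi> = n})"
    by (rule finite_subset) (rule finitely_many_partition_on[OF finite_vertices])
  show "inj_on blocks {\<pi>. diag_order \<pi> = n}"
    by (rule inj_onI) (auto intro: pdiag_eqI)
qed

lemma finite_pdiag_order_le: "finite {\<pi>. diag_order \<pi> \<le> n}"
proof -
  have "{\<pi>. diag_order \<pi> \<le> n} = (\<Union>i\<le>n. {\<pi>. diag_order \<pi> = i})" by auto
  then show ?thesis by (simp add: finite_pdiag_order)
qed

text \<open>Diagrams form a monoid under \<open>\<otimes>\<close> with unit \<open>\<emptyset>\<close>. It is written additively only because
  the convolution product of the type \<open>poly_mapping\<close> expects an additive index monoid.\<close>

instantiation pdiag :: monoid_add
begin

definition zero_pdiag :: pdiag where "0 = empty_diag"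

definition plus_pdiag :: "pdiag \<Rightarrow> pdiag \<Rightarrow> pdiag" where "\<pi> + \<rho> = \<pi> \<otimes> \<rho>"

instance
proof
  fix a b c :: pdiag
  show "a + b + c = a + (b + c)"
    unfolding plus_pdiag_def
    by (rule pdiag_eqI) (simp_all only: diag_order_tensor blocks_tensor image_Un shift_add_image Un_assoc add.assoc)
  have "shift 0 = id" by (rule ext) (simp add: shift_def sum.map_id0 id_def[symmetric])
  then show "0 + a = a"
    unfolding plus_pdiag_def zero_pdiag_def
    by (intro pdiag_eqI) (auto simp: blocks_tensor)
  show "a + 0 = a"
    unfolding plus_pdiag_def zero_pdiag_def
    by (intro pdiag_eqI) (auto simp: blocks_tensor)
qed

end


section \<open>The Hopf algebra \<open>ParSym\<close>\<close>

text \<open>The free vector space with basis \<open>'a\<close> is \<open>'a \<Rightarrow>\<^sub>0 'k\<close>. If \<open>'a\<close> is a monoid, it carries the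
  product extending that of \<open>'a\<close> bilinearly. So \<open>ParSym\<close> is \<open>pdiag \<Rightarrow>\<^sub>0 'k\<close>, and the algebra
  \<open>ParSym \<otimes> ParSym\<close> is \<open>pdiag \<times> pdiag \<Rightarrow>\<^sub>0 'k\<close>, the index \<open>(\<pi>, \<rho>)\<close> standing for
  \<open>H \<pi> \<otimes> H \<rho>\<close>.\<close>

type_synonym 'k parsym = "pdiag \<Rightarrow>\<^sub>0 'k"
type_synonym 'k parsym2 = "pdiag \<times> pdiag \<Rightarrow>\<^sub>0 'k"

definition scale :: "'k::field \<Rightarrow> ('a \<Rightarrow>\<^sub>0 'k) \<Rightarrow> ('a \<Rightarrow>\<^sub>0 'k)" where
  "scale c p = Poly_Mapping.map ((*) c) p"

lemma lookup_scale [simp]: "Poly_Mapping.lookup (scale c p) a = c * Poly_Mapping.lookup p a"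
  unfolding scale_def by transfer (simp add: when_def)

interpretation free_vs: vector_space scale
  by unfold_locales
    (rule poly_mapping_eqI; simp add: lookup_add algebra_simps)+

definition H :: "pdiag \<Rightarrow> 'k::field parsym" where
  "H \<pi> = Poly_Mapping.single \<pi> 1"

lemma H_empty: "H empty_diag = 1"
  by (simp add: H_def zero_pdiag_def[symmetric])

lemma H_mult: "H \<pi> * H \<rho> = H (\<pi> \<otimes> \<rho>)"
  by (simp add: H_def mult_single plus_pdiag_def)

lift_definition tensor :: "('a \<Rightarrow>\<^sub>0 'k::field) \<Rightarrow> ('b \<Rightarrow>\<^sub>0 'k) \<Rightarrow> ('a \<times> 'b \<Rightarrow>\<^sub>0 'k)"
  is "\<lambda>f g (a, b). f a * g b"
  subgoal for f g
    by (rule finite_subset[of _ "{a. f a \<noteq> 0} \<times> {b. g b \<noteq> 0}"]) auto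
  done

lemma lookup_tensor:
  "Poly_Mapping.lookup (tensor x y) a =
     Poly_Mapping.lookup x (fst a) * Poly_Mapping.lookup y (snd a)"
  by transfer (simp add: case_prod_beta)

lemma tensor_H: "tensor (H \<pi>) (H \<rho>) = Poly_Mapping.single (\<pi>, \<rho>) 1"
  unfolding H_def
  by (rule poly_mapping_eqI) (auto simp: lookup_tensor lookup_single when_def split: prod.split)

definition tensor_square :: "'k::field parsym set \<Rightarrow> 'k parsym2 set" where
  "tensor_square U = free_vs.span {tensor x y |x y. x \<in> U \<and> y \<in> U}"

definition comul_irred :: "pdiag \<Rightarrow> 'k::field parsym2" where
  "comul_irred \<pi> = (\<Sum>(G1, G2) \<in> {(G1, G2).
     (G1 = empty_diag \<or> tensor_irreducible G1) \<and> (G2 = empty_diag \<or> tensor_irreducible G2) \<and>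
     G1 \<bullet> G2 = \<pi>}. tensor (H G1) (H G2))"

definition antipode_irred :: "pdiag \<Rightarrow> 'k::field parsym" where
  "antipode_irred \<pi> = (\<Sum>\<rho>s \<in> {\<rho>s. (\<forall>\<rho> \<in> set \<rho>s. \<rho> \<noteq> empty_diag) \<and> foldr (\<bullet>) \<rho>s empty_diag = \<pi>}.
     scale ((-1) ^ length \<rho>s) (prod_list (map H \<rho>s)))"

definition is_comul :: "('k::field parsym \<Rightarrow> 'k parsym2) \<Rightarrow> bool" where
  "is_comul D \<longleftrightarrow> Vector_Spaces.linear scale scale D \<and>
     D (H empty_diag) = tensor (H empty_diag) (H empty_diag) \<and>
     (\<forall>x y. D (x * y) = D x * D y) \<and>
     (\<forall>\<pi>. \<pi> \<noteq> empty_diag \<and> tensor_irreducible \<pi> \<longrightarrow> D (H \<pi>) = comul_irred \<pi>)"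

definition is_antipode :: "('k::field parsym \<Rightarrow> 'k parsym) \<Rightarrow> bool" where
  "is_antipode S \<longleftrightarrow> Vector_Spaces.linear scale scale S \<and>
     S (H empty_diag) = H empty_diag \<and>
     (\<forall>x y. S (x * y) = S y * S x) \<and>
     (\<forall>\<pi>. \<pi> \<noteq> empty_diag \<and> tensor_irreducible \<pi> \<longrightarrow> S (H \<pi>) = antipode_irred \<pi>)"

text \<open>Both conditions are satisfied by exactly one map; see \<open>ex1_comul\<close> and \<open>ex1_antipode\<close>.\<close>

definition comul :: "'k::field parsym \<Rightarrow> 'k parsym2" where
  "comul = (THE D. is_comul D)"

definition antipode :: "'k::field parsym \<Rightarrow> 'k parsym" where
  "antipode = (THE S. is_antipode S)"

definition hopf_subalgebra :: "'k::field parsym set \<Rightarrow> bool" where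
  "hopf_subalgebra U \<longleftrightarrow> free_vs.subspace U \<and>
     H empty_diag \<in> U \<and>
     (\<forall>x \<in> U. \<forall>y \<in> U. x * y \<in> U) \<and>
     comul ` U \<subseteq> tensor_square U \<and>
     antipode ` U \<subseteq> U"


section \<open>Comultiplication and antipode are well defined\<close>

lemma finite_comul_index: "finite {(G1, G2). (G1 = empty_diag \<or> tensor_irreducible G1) \<and>
  (G2 = empty_diag \<or> tensor_irreducible G2) \<and> G1 \<bullet> G2 = \<pi>}"
  by (rule finite_subset[OF _ finite_cartesian_product[
        OF finite_pdiag_order_le[of "diag_order \<pi>"] finite_pdiag_order_le[of "diag_order \<pi>"]]])
    auto

lemma finite_antipode_index:
  "finite {\<rho>s. (\<forall>\<rho> \<in> set \<rho>s. \<rho> \<noteq> empty_diag) \<and> foldr (\<bullet>) \<rho>s empty_diag = \<pi>}"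
proof (rule finite_subset)
  let ?A = "{\<rho>. diag_order \<rho> \<le> diag_order \<pi>}" and ?n = "diag_order \<pi>"
  show "finite {\<rho>s. set \<rho>s \<subseteq> ?A \<and> length \<rho>s \<le> ?n}"
    by (rule finite_lists_length_le[OF finite_pdiag_order_le])
  have ord: "diag_order (foldr (\<bullet>) \<rho>s empty_diag) = (\<Sum>\<rho>\<leftarrow>\<rho>s. diag_order \<rho>)" for \<rho>s
    by (induction \<rho>s) auto
  have len: "length \<rho>s \<le> (\<Sum>\<rho>\<leftarrow>\<rho>s. diag_order \<rho>)" if "\<forall>\<rho> \<in> set \<rho>s. \<rho> \<noteq> empty_diag" for \<rho>s
    using that
  proof (induction \<rho>s)
    case (Cons a \<rho>s)
    then have "0 < diag_order a" by simp
    moreover have "length \<rho>s \<le> (\<Sum>\<rho>\<leftarrow>\<rho>s. diag_order \<rho>)" using Cons by simp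
    ultimately show ?case by (simp del: diag_order_pos_iff)
  qed simp
  have mem: "diag_order \<rho> \<le> (\<Sum>\<rho>\<leftarrow>\<rho>s. diag_order \<rho>)" if "\<rho> \<in> set \<rho>s" for \<rho> \<rho>s
    using that by (intro member_le_sum_list) auto
  show "{\<rho>s. (\<forall>\<rho> \<in> set \<rho>s. \<rho> \<noteq> empty_diag) \<and> foldr (\<bullet>) \<rho>s empty_diag = \<pi>}
      \<subseteq> {\<rho>s. set \<rho>s \<subseteq> ?A \<and> length \<rho>s \<le> ?n}"
    using len mem by (auto simp: ord)
qed

lemma block_cases:
  assumes "X \<in> blocks (\<pi> \<otimes> \<rho>)"
  obtains "X \<in> blocks \<pi>" "X \<subseteq> vertices (diag_order \<pi>)" "X \<noteq> {}"
  | Y where "Y \<in> blocks \<rho>" "X = shift (diag_order \<pi>) ` Y" "X \<inter> vertices (diag_order \<pi>) = {}" "X \<noteq> {}"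
proof -
  have "X \<subseteq> vertices (diag_order \<pi>) \<and> X \<noteq> {}" if "X \<in> blocks \<pi>"
    using that partition_on_blocks[of \<pi>] by (auto simp: partition_on_def)
  moreover have "shift (diag_order \<pi>) ` Y \<inter> vertices (diag_order \<pi>) = {} \<and> Y \<noteq> {}"
    if "Y \<in> blocks \<rho>" for Y
  proof -
    have "Y \<subseteq> vertices (diag_order \<rho>)" "Y \<noteq> {}"
      using that partition_on_blocks[of \<rho>] by (auto simp: partition_on_def)
    then have "shift (diag_order \<pi>) ` Y \<subseteq> shift (diag_order \<pi>) ` vertices (diag_order \<rho>)"
      by blast
    then show ?thesis using \<open>Y \<noteq> {}\<close> by (auto simp: shift_vertices)
  qed
  ultimately show thesis
    using assms that by (auto simp: blocks_tensor)
qed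

lemma blocks_left: "X \<in> blocks \<pi> \<longleftrightarrow> X \<in> blocks (\<pi> \<otimes> \<rho>) \<and> X \<subseteq> vertices (diag_order \<pi>)"
proof
  assume "X \<in> blocks \<pi>"
  then show "X \<in> blocks (\<pi> \<otimes> \<rho>) \<and> X \<subseteq> vertices (diag_order \<pi>)"
    using partition_on_blocks[of \<pi>] by (auto simp: partition_on_def blocks_tensor)
next
  assume "X \<in> blocks (\<pi> \<otimes> \<rho>) \<and> X \<subseteq> vertices (diag_order \<pi>)"
  then show "X \<in> blocks \<pi>" by (auto elim!: block_cases)
qed

lemma blocks_right:
  "Y \<in> blocks \<rho> \<longleftrightarrow>
     shift (diag_order \<pi>) ` Y \<in> blocks (\<pi> \<otimes> \<rho>) \<and> Y \<subseteq> vertices (diag_order \<rho>)"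
proof
  assume "Y \<in> blocks \<rho>"
  then show "shift (diag_order \<pi>) ` Y \<in> blocks (\<pi> \<otimes> \<rho>) \<and> Y \<subseteq> vertices (diag_order \<rho>)"
    using partition_on_blocks[of \<rho>] by (auto simp: partition_on_def blocks_tensor)
next
  assume *: "shift (diag_order \<pi>) ` Y \<in> blocks (\<pi> \<otimes> \<rho>) \<and> Y \<subseteq> vertices (diag_order \<rho>)"
  then have "shift (diag_order \<pi>) ` Y \<subseteq> shift (diag_order \<pi>) ` vertices (diag_order \<rho>)"
    by blast
  then have "shift (diag_order \<pi>) ` Y \<inter> vertices (diag_order \<pi>) = {}"
    by (auto simp: shift_vertices)
  with * show "Y \<in> blocks \<rho>" by (auto elim!: block_cases)
qed

lemma tensor_left_cancel: "\<pi> \<otimes> \<rho> = \<pi> \<otimes> \<rho>' \<Longrightarrow> \<rho> = \<rho>'"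
proof (rule pdiag_eqI)
  assume eq: "\<pi> \<otimes> \<rho> = \<pi> \<otimes> \<rho>'"
  then have "diag_order (\<pi> \<otimes> \<rho>) = diag_order (\<pi> \<otimes> \<rho>')" by simp
  then show ord: "diag_order \<rho> = diag_order \<rho>'" by simp
  show "blocks \<rho> = blocks \<rho>'"
  proof (rule set_eqI)
    fix Y
    show "Y \<in> blocks \<rho> \<longleftrightarrow> Y \<in> blocks \<rho>'"
      using blocks_right[of Y \<rho> \<pi>] blocks_right[of Y \<rho>' \<pi>] by (simp only: eq ord)
  qed
qed

lemma tensor_refine:
  assumes eq: "\<pi> \<otimes> \<rho> = \<pi>' \<otimes> \<rho>'" and le: "diag_order \<pi> \<le> diag_order \<pi>'"
  obtains \<sigma> where "\<pi>' = \<pi> \<otimes> \<sigma>"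
proof -
  define k k' where "k = diag_order \<pi>" and "k' = diag_order \<pi>'"
  have kk': "k \<le> k'" using le by (simp add: k_def k'_def)
  have "diag_order (\<pi> \<otimes> \<rho>) = diag_order (\<pi>' \<otimes> \<rho>')" using eq by simp
  then have ord: "k + diag_order \<rho> = k' + diag_order \<rho>'" by (simp add: k_def k'_def)
  define m where "m = k' - k"
  have mle: "m \<le> diag_order \<rho>" using ord kk' by (simp add: m_def)
  have km: "k + m = k'" using kk' by (simp add: m_def)
  define B where "B = {Y \<in> blocks \<rho>. Y \<subseteq> vertices m}"
  have split: "Y \<subseteq> vertices m" if Y: "Y \<in> blocks \<rho>" "y \<in> Y" "y \<in> vertices m" for Y y
  proof -
    have "shift k ` Y \<in> blocks (\<pi>' \<otimes> \<rho>')"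
      using Y eq by (auto simp: k_def blocks_right[of Y \<rho> \<pi>])
    moreover have "shift k y \<in> vertices k'"
      using Y(3) shift_vertices[of k m] km by auto
    ultimately have "shift k ` Y \<subseteq> vertices k'"
      using Y(2) by (auto elim!: block_cases simp: k'_def)
    moreover have "Y \<subseteq> vertices (diag_order \<rho>)"
      using Y by (auto simp: blocks_right[of Y \<rho> \<pi>])
    then have "shift k ` Y \<subseteq> shift k ` vertices (diag_order \<rho>)" by blast
    then have "shift k ` Y \<inter> vertices k = {}" by (auto simp: shift_vertices)
    ultimately have "shift k ` Y \<subseteq> shift k ` vertices m"
      by (auto simp: shift_vertices km)
    then show ?thesis by (simp add: inj_image_subset_iff[OF inj_shift])
  qed
  have part: "partition_on (vertices m) B"
  proof (rule partition_onI)
    have cov: "\<Union> (blocks \<rho>) = vertices (diag_order \<rho>)"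
      using partition_on_blocks[of \<rho>] by (simp add: partition_on_def)
    show "\<Union> B = vertices m"
    proof
      show "vertices m \<subseteq> \<Union> B"
      proof
        fix x assume x: "x \<in> vertices m"
        then have "x \<in> \<Union> (blocks \<rho>)" using vertices_mono[OF mle] cov by auto
        then obtain Y where "Y \<in> blocks \<rho>" "x \<in> Y" by auto
        then show "x \<in> \<Union> B" using split x by (auto simp: B_def)
      qed
    qed (auto simp: B_def)
    show "{} \<notin> B" using partition_on_blocks[of \<rho>] by (auto simp: B_def partition_on_def)
    show "disjnt p q" if "p \<in> B" "q \<in> B" "p \<noteq> q" for p q
      using that partition_on_blocks[of \<rho>]
      by (auto simp: B_def partition_on_def pairwise_def)
  qed
  define \<sigma> where "\<sigma> = Abs_pdiag (m, B)"
  have \<sigma>: "diag_order \<sigma> = m" "blocks \<sigma> = B"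
    using part by (auto simp: \<sigma>_def diag_order.rep_eq blocks.rep_eq Abs_pdiag_inverse)
  have "\<pi>' = \<pi> \<otimes> \<sigma>"
  proof (rule pdiag_eqI)
    show "diag_order \<pi>' = diag_order (\<pi> \<otimes> \<sigma>)"
      using km by (simp add: \<sigma> k_def k'_def)
    show "blocks \<pi>' = blocks (\<pi> \<otimes> \<sigma>)"
    proof (intro set_eqI iffI)
      fix X assume "X \<in> blocks \<pi>'"
      then have X: "X \<in> blocks (\<pi> \<otimes> \<rho>)" "X \<subseteq> vertices k'"
        by (auto simp: blocks_left[of X \<pi>' \<rho>'] eq k'_def)
      from X(1) show "X \<in> blocks (\<pi> \<otimes> \<sigma>)"
      proof (cases rule: block_cases)
        case 1
        then show ?thesis by (simp add: blocks_tensor)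
      next
        case (2 Y)
        then have "shift k ` Y \<subseteq> shift k ` vertices m"
          using X(2) by (simp add: shift_vertices km) (auto simp: k_def)
        then have "Y \<in> B"
          using 2 by (auto simp: B_def inj_image_subset_iff[OF inj_shift])
        then show ?thesis using 2 by (auto simp: blocks_tensor \<sigma> k_def)
      qed
    next
      fix X assume "X \<in> blocks (\<pi> \<otimes> \<sigma>)"
      then show "X \<in> blocks \<pi>'"
      proof (cases rule: block_cases)
        case 1
        then have "X \<in> blocks (\<pi>' \<otimes> \<rho>')" by (simp add: eq[symmetric] blocks_tensor)
        moreover have "X \<subseteq> vertices k'" using 1 vertices_mono[OF kk'] by (auto simp: k_def)
        ultimately show ?thesis by (simp add: blocks_left[of X \<pi>' \<rho>'] k'_def)
      next
        case (2 Y)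
        then have Y: "Y \<in> blocks \<rho>" "Y \<subseteq> vertices m" by (auto simp: \<sigma> B_def)
        then have "X \<in> blocks (\<pi>' \<otimes> \<rho>')" by (simp add: eq[symmetric] blocks_tensor 2)
        moreover have "shift k ` Y \<subseteq> shift k ` vertices m" using Y(2) by blast
        then have "X \<subseteq> vertices k'" using 2 by (simp add: shift_vertices km) (auto simp: k_def)
        ultimately show ?thesis by (simp add: blocks_left[of X \<pi>' \<rho>'] k'_def)
      qed
    qed
  qed
  then show thesis by (rule that)
qed

definition is_factors :: "pdiag list \<Rightarrow> bool" where
  "is_factors ps \<longleftrightarrow> (\<forall>p \<in> set ps. p \<noteq> empty_diag \<and> tensor_irreducible p)"

lemma factors_exist: "\<exists>ps. is_factors ps \<and> sum_list ps = \<pi>"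
proof (induction "diag_order \<pi>" arbitrary: \<pi> rule: less_induct)
  case less
  consider "\<pi> = empty_diag" | "\<pi> \<noteq> empty_diag" "tensor_irreducible \<pi>"
    | a b where "a \<noteq> empty_diag" "b \<noteq> empty_diag" "\<pi> = a \<otimes> b"
    by (auto simp: tensor_irreducible_def)
  then show ?case
  proof cases
    case 1
    then show ?thesis by (intro exI[of _ "[]"]) (simp add: is_factors_def zero_pdiag_def)
  next
    case 2
    then show ?thesis by (intro exI[of _ "[\<pi>]"]) (simp add: is_factors_def)
  next
    case 3
    then have "0 < diag_order a" "0 < diag_order b" by simp_all
    then have "diag_order a < diag_order \<pi>" "diag_order b < diag_order \<pi>"
      unfolding 3(3) diag_order_tensor by linarith+
    then obtain ps qs where "is_factors ps" "sum_list ps = a" "is_factors qs" "sum_list qs = b"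
      using less by blast
    then show ?thesis
      using 3 by (intro exI[of _ "ps @ qs"]) (auto simp: is_factors_def plus_pdiag_def)
  qed
qed

lemma irreducible_prefix_eq:
  assumes "p \<otimes> a = q \<otimes> b" "diag_order p \<le> diag_order q"
    and "p \<noteq> empty_diag" "tensor_irreducible q"
  shows "p = q"
proof -
  obtain \<sigma> where \<sigma>: "q = p \<otimes> \<sigma>" using assms by (blast elim: tensor_refine)
  then have "\<sigma> = empty_diag" using assms by (auto simp: tensor_irreducible_def)
  then show ?thesis using \<sigma> add_0_right[of p] by (simp add: plus_pdiag_def zero_pdiag_def)
qed

lemma factors_unique:
  "is_factors ps \<Longrightarrow> is_factors qs \<Longrightarrow> sum_list ps = sum_list qs \<Longrightarrow> ps = qs"
proof (induction ps arbitrary: qs)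
  case Nil
  show ?case
  proof (cases qs)
    case (Cons q qs')
    then have "0 < diag_order q" using Nil by (simp add: is_factors_def)
    then have "diag_order (sum_list qs) \<noteq> 0"
      unfolding Cons sum_list.Cons plus_pdiag_def diag_order_tensor by linarith
    moreover have "sum_list qs = empty_diag" using Nil by (simp add: zero_pdiag_def)
    ultimately show ?thesis by simp
  qed simp
next
  case (Cons p ps)
  show ?case
  proof (cases qs)
    case Nil
    then have "diag_order (sum_list (p # ps)) = 0" using Cons by (simp add: zero_pdiag_def)
    moreover have "p \<noteq> empty_diag" using Cons by (simp add: is_factors_def)
    ultimately show ?thesis
      unfolding sum_list.Cons plus_pdiag_def diag_order_tensor by simp
  next
    case (Cons q qs')
    note qs = this
    have eq: "p \<otimes> sum_list ps = q \<otimes> sum_list qs'"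
      using Cons.prems(3) qs by (simp add: plus_pdiag_def)
    have pq: "p \<noteq> empty_diag" "tensor_irreducible p" "q \<noteq> empty_diag" "tensor_irreducible q"
      using Cons.prems qs by (auto simp: is_factors_def)
    have "p = q"
      using irreducible_prefix_eq[OF eq] irreducible_prefix_eq[OF eq[symmetric]] pq
      by (cases "diag_order p \<le> diag_order q") auto
    moreover from this eq have "sum_list ps = sum_list qs'"
      using tensor_left_cancel by blast
    then have "ps = qs'"
      using Cons.prems qs by (intro Cons.IH) (auto simp: is_factors_def)
    ultimately show ?thesis using qs by simp
  qed
qed

definition factors :: "pdiag \<Rightarrow> pdiag list" where
  "factors \<pi> = (THE ps. is_factors ps \<and> sum_list ps = \<pi>)"

lemma factors: "is_factors (factors \<pi>)" "sum_list (factors \<pi>) = \<pi>"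
proof -
  have "\<exists>!ps. is_factors ps \<and> sum_list ps = \<pi>"
    using factors_exist factors_unique by blast
  from theI'[OF this] show "is_factors (factors \<pi>)" "sum_list (factors \<pi>) = \<pi>"
    by (simp_all add: factors_def)
qed

lemma factors_eqI: "is_factors ps \<Longrightarrow> sum_list ps = \<pi> \<Longrightarrow> factors \<pi> = ps"
  using factors factors_unique by blast

lemma factors_zero: "factors 0 = []"
  by (rule factors_eqI) (auto simp: is_factors_def)

lemma factors_add: "factors (\<pi> + \<rho>) = factors \<pi> @ factors \<rho>"
  using factors[of \<pi>] factors[of \<rho>] by (intro factors_eqI) (auto simp: is_factors_def)

lemma factors_irreducible:
  "\<pi> \<noteq> empty_diag \<Longrightarrow> tensor_irreducible \<pi> \<Longrightarrow> factors \<pi> = [\<pi>]"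
  by (rule factors_eqI) (auto simp: is_factors_def)

lemma scale_conv_mult: "scale c p = Poly_Mapping.single 0 c * p"
  for p :: "'a::monoid_add \<Rightarrow>\<^sub>0 'k::field"
  by (simp add: scale_def mult_map_scale_conv_mult)

lemma scale_mult_left: "scale c p * q = scale c (p * q)"
  for p :: "'a::monoid_add \<Rightarrow>\<^sub>0 'k::field"
  by (simp add: scale_conv_mult mult.assoc)

lemma scale_single: "scale c (Poly_Mapping.single a b) = Poly_Mapping.single a (c * b)"
  by (rule poly_mapping_eqI) (simp add: lookup_single when_def)

lemma poly_mapping_expand:
  "p = (\<Sum>a \<in> Poly_Mapping.keys p. scale (Poly_Mapping.lookup p a) (Poly_Mapping.single a 1))"
  by (rule poly_mapping_eqI)
    (simp add: scale_single lookup_sum lookup_single when_def in_keys_iff)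

lemma scale_mult_right: "p * scale c q = scale c (p * q)"
  for p :: "'a::monoid_add \<Rightarrow>\<^sub>0 'k::field"
proof -
  have *: "Poly_Mapping.single a b * Poly_Mapping.single 0 c =
      Poly_Mapping.single 0 c * Poly_Mapping.single a b" for a :: 'a and b :: 'k
    by (simp add: mult_single mult.commute)
  have "p * Poly_Mapping.single 0 c = Poly_Mapping.single 0 c * p"
    by (subst (1 2) poly_mapping_expand[of p])
      (simp add: scale_single sum_distrib_left sum_distrib_right *)
  then show ?thesis by (simp add: scale_conv_mult mult.assoc[symmetric])
qed

definition lin_ext :: "(pdiag \<Rightarrow> ('a \<Rightarrow>\<^sub>0 'k)) \<Rightarrow> 'k::field parsym \<Rightarrow> ('a \<Rightarrow>\<^sub>0 'k)" where
  "lin_ext d p = (\<Sum>\<pi> \<in> Poly_Mapping.keys p. scale (Poly_Mapping.lookup p \<pi>) (d \<pi>))"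

lemma lin_ext_superset:
  assumes "finite A" "Poly_Mapping.keys p \<subseteq> A"
  shows "lin_ext d p = (\<Sum>\<pi> \<in> A. scale (Poly_Mapping.lookup p \<pi>) (d \<pi>))"
  unfolding lin_ext_def using assms
  by (intro sum.mono_neutral_left) (auto simp: in_keys_iff)

lemma lin_ext_add: "lin_ext d (p + q) = lin_ext d p + lin_ext d q"
proof -
  let ?A = "Poly_Mapping.keys p \<union> Poly_Mapping.keys q"
  have "Poly_Mapping.keys (p + q) \<subseteq> ?A" by (rule keys_add)
  then show ?thesis
    by (simp add: lin_ext_superset[of ?A] lookup_add free_vs.scale_left_distrib sum.distrib)
qed

lemma lin_ext_scale: "lin_ext d (scale c p) = scale c (lin_ext d p)"
proof -
  have "Poly_Mapping.keys (scale c p) \<subseteq> Poly_Mapping.keys p" by (auto simp: in_keys_iff)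
  then show ?thesis
    by (simp add: lin_ext_superset[of "Poly_Mapping.keys p"] free_vs.scale_sum_right)
qed

lemma linear_lin_ext: "Vector_Spaces.linear scale scale (lin_ext d)"
  unfolding Vector_Spaces.linear_iff
  by (intro conjI allI lin_ext_add lin_ext_scale) (rule free_vs.vector_space_axioms)+

lemma lin_ext_sum: "lin_ext d (\<Sum>x\<in>A. f x) = (\<Sum>x\<in>A. lin_ext d (f x))"
  by (induction A rule: infinite_finite_induct) (auto simp: lin_ext_add lin_ext_def[of d 0])

lemma lin_ext_H [simp]: "lin_ext d (H \<pi>) = d \<pi>"
  by (simp add: lin_ext_def H_def)

lemma parsym_expand:
  "p = (\<Sum>\<pi> \<in> Poly_Mapping.keys p. scale (Poly_Mapping.lookup p \<pi>) (H \<pi>))"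
  unfolding H_def by (rule poly_mapping_expand)

lemma lin_ext_mult:
  fixes d :: "pdiag \<Rightarrow> ('a::monoid_add \<Rightarrow>\<^sub>0 'k::field)"
  assumes "\<And>\<pi> \<rho>. d (\<pi> \<otimes> \<rho>) = d \<pi> * d \<rho>"
  shows "lin_ext d (p * q) = lin_ext d p * lin_ext d q"
  by (subst (1 2) parsym_expand[of p], subst (1 2) parsym_expand[of q])
    (simp add: sum_distrib_left sum_distrib_right scale_mult_left scale_mult_right
      lin_ext_sum lin_ext_scale H_mult assms)

lemma lin_ext_antimult:
  fixes d :: "pdiag \<Rightarrow> ('a::monoid_add \<Rightarrow>\<^sub>0 'k::field)"
  assumes "\<And>\<pi> \<rho>. d (\<pi> \<otimes> \<rho>) = d \<rho> * d \<pi>"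
  shows "lin_ext d (p * q) = lin_ext d q * lin_ext d p"
proof -
  have "lin_ext d (p * q) = (\<Sum>\<rho> \<in> Poly_Mapping.keys q. \<Sum>\<pi> \<in> Poly_Mapping.keys p.
      scale (Poly_Mapping.lookup p \<pi> * Poly_Mapping.lookup q \<rho>) (d \<rho> * d \<pi>))"
    by (subst parsym_expand[of p], subst parsym_expand[of q])
      (simp add: sum_distrib_left sum_distrib_right scale_mult_left scale_mult_right
        lin_ext_sum lin_ext_scale H_mult assms free_vs.scale_sum_right mult.commute)
  also have "\<dots> = lin_ext d q * lin_ext d p"
    unfolding lin_ext_def
    by (subst sum_product) (simp add: scale_mult_left scale_mult_right mult.commute)
  finally show ?thesis .
qed

lemma linear_eqI:
  fixes f g :: "'k::field parsym \<Rightarrow> ('a \<Rightarrow>\<^sub>0 'k)"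
  assumes f: "Vector_Spaces.linear scale scale f" and g: "Vector_Spaces.linear scale scale g"
    and H: "\<And>\<pi>. f (H \<pi>) = g (H \<pi>)"
  shows "f = g"
proof
  fix p
  interpret f: Vector_Spaces.linear scale scale f by (rule f)
  interpret g: Vector_Spaces.linear scale scale g by (rule g)
  show "f p = g p"
    by (subst (1 2) parsym_expand[of p]) (simp add: f.sum g.sum f.scale g.scale H)
qed

lemma pdiag_induct [case_names empty irreducible]:
  assumes "P empty_diag"
    and "\<And>p \<pi>. p \<noteq> empty_diag \<Longrightarrow> tensor_irreducible p \<Longrightarrow> P \<pi> \<Longrightarrow> P (p \<otimes> \<pi>)"
  shows "P \<pi>"
proof -
  have "P (sum_list ps)" if "is_factors ps" for ps
    using that assms
    by (induction ps) (auto simp: is_factors_def zero_pdiag_def plus_pdiag_def)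
  from this[OF factors(1)[of \<pi>]] show ?thesis by (simp add: factors)
qed

lemma tensor_H_empty: "tensor (H empty_diag) (H empty_diag) = 1"
  by (simp add: tensor_H zero_pdiag_def[symmetric] zero_prod_def[symmetric])

theorem ex1_comul: "\<exists>!D :: 'k::field parsym \<Rightarrow> 'k parsym2. is_comul D"
proof (rule ex_ex1I)
  define d :: "pdiag \<Rightarrow> 'k parsym2" where
    "d \<pi> = prod_list (map comul_irred (factors \<pi>))" for \<pi>
  have "d (\<pi> \<otimes> \<rho>) = d \<pi> * d \<rho>" for \<pi> \<rho>
    by (simp add: d_def factors_add plus_pdiag_def[symmetric])
  moreover have "d empty_diag = 1"
    by (simp add: d_def factors_zero zero_pdiag_def[symmetric])
  moreover have "d \<pi> = comul_irred \<pi>" if "\<pi> \<noteq> empty_diag" "tensor_irreducible \<pi>" for \<pi>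
    using that by (simp add: d_def factors_irreducible)
  ultimately have "is_comul (lin_ext d)"
    unfolding is_comul_def by (simp add: linear_lin_ext lin_ext_mult tensor_H_empty)
  then show "\<exists>D :: 'k parsym \<Rightarrow> 'k parsym2. is_comul D" by blast
next
  fix D E :: "'k parsym \<Rightarrow> 'k parsym2"
  assume DE: "is_comul D" "is_comul E"
  have "D (H \<pi>) = E (H \<pi>)" for \<pi>
    using DE by (induction \<pi> rule: pdiag_induct) (simp_all add: is_comul_def H_mult[symmetric])
  then show "D = E" using DE by (intro linear_eqI) (simp_all add: is_comul_def)
qed

theorem ex1_antipode: "\<exists>!S :: 'k::field parsym \<Rightarrow> 'k parsym. is_antipode S"
proof (rule ex_ex1I)
  define d :: "pdiag \<Rightarrow> 'k parsym" where
    "d \<pi> = prod_list (rev (map antipode_irred (factors \<pi>)))" for \<pi>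
  have "d (\<pi> \<otimes> \<rho>) = d \<rho> * d \<pi>" for \<pi> \<rho>
    by (simp add: d_def factors_add plus_pdiag_def[symmetric])
  moreover have "d empty_diag = 1"
    by (simp add: d_def factors_zero zero_pdiag_def[symmetric])
  moreover have "d \<pi> = antipode_irred \<pi>" if "\<pi> \<noteq> empty_diag" "tensor_irreducible \<pi>" for \<pi>
    using that by (simp add: d_def factors_irreducible)
  ultimately have "is_antipode (lin_ext d)"
    unfolding is_antipode_def by (simp add: linear_lin_ext lin_ext_antimult H_empty[symmetric])
  then show "\<exists>S :: 'k parsym \<Rightarrow> 'k parsym. is_antipode S" by blast
next
  fix S T :: "'k parsym \<Rightarrow> 'k parsym"
  assume ST: "is_antipode S" "is_antipode T"
  have "S (H \<pi>) = T (H \<pi>)" for \<pi>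
    using ST by (induction \<pi> rule: pdiag_induct) (simp_all add: is_antipode_def H_mult[symmetric])
  then show "S = T" using ST by (intro linear_eqI) (simp_all add: is_antipode_def)
qed

lemma is_comul_comul: "is_comul comul"
  unfolding comul_def by (rule theI'[OF ex1_comul])

lemma is_antipode_antipode: "is_antipode antipode"
  unfolding antipode_def by (rule theI'[OF ex1_antipode])

end

(* Every block of a tensor factor of a diagram is a translate of a block of the product, and every
   block of a bullet factor is a translate of a subset of a block of the product; so all tensor and
   bullet factors of a matching are matchings. Hence the defining formulas of the comultiplication
   and the antipode on an irreducible matching only involve matchings, and multiplicativity extends
   this to all matchings. *)

theory Submission
  imports Defs
begin

lemma finite_block: "B \<in> blocks \<pi> \<Longrightarrow> finite B"
  using partition_onD1[OF partition_on_blocks[of \<pi>]] finite_vertices[of "diag_order \<pi>"]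
  by (metis Union_upper finite_subset)

lemma card_shift_image: "card (shift k ` B) = card B"
  by (rule card_image) (rule inj_on_subset[OF inj_shift subset_UNIV])

lemma matching_empty: "matching empty_diag"
  by (simp add: matching_def)

text \<open>Shifting is injective, so the blocks of a product keep the sizes they have in the
  factors. This carries the matching property to all irreducible factors.\<close>

lemma matching_tensor_iff: "matching (\<pi> \<otimes> \<rho>) \<longleftrightarrow> matching \<pi> \<and> matching \<rho>"
  unfolding matching_def blocks_tensor ball_Un ball_simps(9) card_shift_image ..

lemma matching_if_refines:
  assumes "matching \<rho>" and "\<And>B. B \<in> blocks \<pi> \<Longrightarrow> \<exists>C \<in> blocks \<rho>. B \<subseteq> C"
  shows "matching \<pi>"
  unfolding matching_def
proof
  fix B assume "B \<in> blocks \<pi>"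
  then obtain C where "C \<in> blocks \<rho>" "B \<subseteq> C" using assms(2) by blast
  then show "card B \<le> 2"
    \<comment> \<open>Finiteness of \<open>C\<close> matters: an infinite set would have
      \<open>card\<close> 0.\<close>
    using assms(1) card_mono[OF finite_block[of C \<rho>], of B] by (auto simp: matching_def)
qed

text \<open>Merging only enlarges blocks, so \<open>\<pi> \<otimes> \<rho>\<close> refines
  \<open>\<pi> \<bullet> \<rho>\<close>. The converse fails: two merged blocks of size two give one
  of size four.\<close>

lemma matching_bulletD:
  assumes "matching (\<pi> \<bullet> \<rho>)"
  shows "matching \<pi> \<and> matching \<rho>"
proof (cases "\<pi> = empty_diag \<or> \<rho> = empty_diag")
  case True
  then show ?thesis using assms by (auto simp: matching_empty)
next
  case False
  have "matching (\<pi> \<otimes> \<rho>)"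
    by (rule matching_if_refines[OF assms])
      (use False in \<open>auto simp: blocks_bullet merge_blocks_def\<close>)
  then show ?thesis by (simp add: matching_tensor_iff)
qed

lemma matching_foldr_bulletD:
  "matching (foldr (\<bullet>) \<rho>s empty_diag) \<Longrightarrow> \<rho> \<in> set \<rho>s \<Longrightarrow> matching \<rho>"
  by (induction \<rho>s) (auto dest: matching_bulletD)

text \<open>Turns span membership into a condition on supports, where closure under products can be
  checked.\<close>

lemma span_single_eq:
  "free_vs.span {Poly_Mapping.single a (1::'k::field) |a. a \<in> A} = {p. Poly_Mapping.keys p \<subseteq> A}"
proof (intro set_eqI iffI)
  fix p :: "'a \<Rightarrow>\<^sub>0 'k"
  assume "p \<in> free_vs.span {Poly_Mapping.single a 1 |a. a \<in> A}"
  then show "p \<in> {p. Poly_Mapping.keys p \<subseteq> A}"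
  proof (induction rule: free_vs.span_induct_alt)
    case (step c x y)
    then obtain a where a: "x = Poly_Mapping.single a 1" "a \<in> A" by blast
    have "Poly_Mapping.keys (scale c x) \<subseteq> A" using a by (simp add: scale_single)
    with step show ?case using keys_add[of "scale c x" y] by blast
  qed simp
next
  fix p :: "'a \<Rightarrow>\<^sub>0 'k"
  assume "p \<in> {p. Poly_Mapping.keys p \<subseteq> A}"
  then have "(\<Sum>a \<in> Poly_Mapping.keys p. scale (Poly_Mapping.lookup p a) (Poly_Mapping.single a 1))
      \<in> free_vs.span {Poly_Mapping.single a (1::'k) |a. a \<in> A}"
    by (intro free_vs.span_sum free_vs.span_scale free_vs.span_base) auto
  then show "p \<in> free_vs.span {Poly_Mapping.single a 1 |a. a \<in> A}"
    by (simp only: poly_mapping_expand[symmetric])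
qed

text \<open>The support of a product lies in the sumset of the supports. A general index monoid
  covers both diagrams and pairs of diagrams.\<close>

lemma span_single_mult:
  fixes A :: "'a::monoid_add set"
  assumes A: "\<And>a b. a \<in> A \<Longrightarrow> b \<in> A \<Longrightarrow> a + b \<in> A"
    and x: "x \<in> free_vs.span {Poly_Mapping.single a (1::'k::field) |a. a \<in> A}"
    and y: "y \<in> free_vs.span {Poly_Mapping.single a (1::'k::field) |a. a \<in> A}"
  shows "x * y \<in> free_vs.span {Poly_Mapping.single a (1::'k::field) |a. a \<in> A}"
proof -
  have "Poly_Mapping.keys x \<subseteq> A" "Poly_Mapping.keys y \<subseteq> A"
    using x y by (simp_all add: span_single_eq)
  then have "Poly_Mapping.keys (x * y) \<subseteq> A"
    using A keys_mult[of x y] by (auto simp: subset_iff)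
  then show ?thesis by (simp add: span_single_eq)
qed

lemma linear_image_span_subset:
  assumes f: "Vector_Spaces.linear scale scale f" and W: "free_vs.subspace W" and S: "f ` S \<subseteq> W"
  shows "f ` free_vs.span S \<subseteq> W"
proof -
  interpret Vector_Spaces.linear scale scale f by (rule f)
  show ?thesis unfolding span_image[symmetric] using S W by (rule free_vs.span_minimal)
qed

lemma matching_add: "matching \<pi> \<Longrightarrow> matching \<rho> \<Longrightarrow> matching (\<pi> + \<rho>)"
  by (simp add: plus_pdiag_def matching_tensor_iff)

abbreviation matching_span :: "'k::field parsym set" where
  "matching_span \<equiv> free_vs.span {H \<pi> |\<pi>. matching \<pi>}"

text \<open>A basis description inside the tensor square; writing it with \<open>single\<close>
  instead of \<open>tensor\<close> makes \<open>span_single_mult\<close> applicable.\<close>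

abbreviation matching_span2 :: "'k::field parsym2 set" where
  "matching_span2 \<equiv>
     free_vs.span {Poly_Mapping.single a 1 |a. a \<in> Collect matching \<times> Collect matching}"

lemma H_in_matching_span: "matching \<pi> \<Longrightarrow> H \<pi> \<in> matching_span"
  by (rule free_vs.span_base) blast

lemma matching_span_mult:
  "x \<in> matching_span \<Longrightarrow> y \<in> matching_span \<Longrightarrow> x * y \<in> matching_span"
  using span_single_mult[of "Collect matching" x y] by (simp add: matching_add H_def)

lemma matching_span2_mult:
  "x \<in> matching_span2 \<Longrightarrow> y \<in> matching_span2 \<Longrightarrow> x * y \<in> matching_span2"
  by (rule span_single_mult) (auto simp: matching_add)

lemma tensor_H_in_matching_span2:
  "matching \<pi> \<Longrightarrow> matching \<rho> \<Longrightarrow> tensor (H \<pi>) (H \<rho>) \<in> matching_span2"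
  unfolding tensor_H by (rule free_vs.span_base) blast

lemma matching_span2_subset: "matching_span2 \<subseteq> tensor_square matching_span"
  unfolding tensor_square_def
proof (rule free_vs.span_mono, clarify)
  fix \<pi> \<rho> assume "matching \<pi>" "matching \<rho>"
  then show "\<exists>x y. Poly_Mapping.single (\<pi>, \<rho>) 1 = tensor x y \<and>
      x \<in> matching_span \<and> y \<in> matching_span"
    using H_in_matching_span tensor_H[symmetric] by blast
qed

text \<open>Each summand is indexed by a pair with \<open>G1 \<bullet> G2 = \<pi>\<close>, so both
  parts are matchings by \<open>matching_bulletD\<close>.\<close>

lemma comul_irred_matching: "matching \<pi> \<Longrightarrow> comul_irred \<pi> \<in> matching_span2"
  unfolding comul_irred_def
  by (intro free_vs.span_sum, clarify)
    (intro tensor_H_in_matching_span2; blast dest: matching_bulletD)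

lemma antipode_irred_matching: "matching \<pi> \<Longrightarrow> antipode_irred \<pi> \<in> matching_span"
proof -
  have prod: "prod_list (map H \<rho>s) \<in> matching_span" if "\<forall>\<rho> \<in> set \<rho>s. matching \<rho>" for \<rho>s
    using that
    by (induction \<rho>s)
      \<comment> \<open>The empty product \<open>1\<close> is read as \<open>H empty_diag\<close>, a
        basis element of the span.\<close>
      (auto simp: H_empty[symmetric] matching_empty intro: H_in_matching_span matching_span_mult)
  show "matching \<pi> \<Longrightarrow> antipode_irred \<pi> \<in> matching_span"
    unfolding antipode_irred_def
    by (intro free_vs.span_sum free_vs.span_scale prod) (auto dest: matching_foldr_bulletD)
qed

lemma comul_H_empty: "comul (H empty_diag) = tensor (H empty_diag) (H empty_diag)"
  using is_comul_comul unfolding is_comul_def by blast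

text \<open>Splits off the leading irreducible factor, on which the explicit formula holds, in the
  shape required by \<open>pdiag_induct\<close>.\<close>

lemma comul_H_irreducible_tensor:
  "p \<noteq> empty_diag \<Longrightarrow> tensor_irreducible p \<Longrightarrow> comul (H (p \<otimes> \<pi>)) = comul_irred p * comul (H \<pi>)"
  using is_comul_comul unfolding is_comul_def H_mult[symmetric] by metis

text \<open>Induction over the irreducible factors: by \<open>matching_tensor_iff\<close> both
  \<open>p\<close> and the rest are matchings, and \<open>matching_span2\<close> is closed under
  products.\<close>

lemma comul_H_matching: "matching \<pi> \<Longrightarrow> comul (H \<pi>) \<in> matching_span2"
proof (induction \<pi> rule: pdiag_induct)
  case empty
  then show ?case unfolding comul_H_empty by (intro tensor_H_in_matching_span2)
next
  case (irreducible p \<pi>)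
  then show ?case
    unfolding comul_H_irreducible_tensor[OF irreducible(1,2)] matching_tensor_iff
    by (intro matching_span2_mult comul_irred_matching) blast+
qed

lemma antipode_H_empty: "antipode (H empty_diag) = H empty_diag"
  using is_antipode_antipode unfolding is_antipode_def by blast

text \<open>Since the antipode reverses products, the image of the leading factor appears on the
  right.\<close>

lemma antipode_H_irreducible_tensor:
  "p \<noteq> empty_diag \<Longrightarrow> tensor_irreducible p \<Longrightarrow>
    antipode (H (p \<otimes> \<pi>)) = antipode (H \<pi>) * antipode_irred p"
  using is_antipode_antipode unfolding is_antipode_def H_mult[symmetric] by metis

lemma antipode_H_matching: "matching \<pi> \<Longrightarrow> antipode (H \<pi>) \<in> matching_span"
proof (induction \<pi> rule: pdiag_induct)
  case empty
  then show ?case unfolding antipode_H_empty by (intro H_in_matching_span)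
next
  case (irreducible p \<pi>)
  then show ?case
    unfolding antipode_H_irreducible_tensor[OF irreducible(1,2)] matching_tensor_iff
    by (intro matching_span_mult antipode_irred_matching) blast+
qed

theorem theorem4p2:
  shows "hopf_subalgebra (free_vs.span {H \<pi> |\<pi>. matching \<pi>} :: 'k::field parsym set)"
  unfolding hopf_subalgebra_def
proof (intro conjI ballI)
  show "comul ` matching_span \<subseteq> tensor_square (matching_span :: 'k parsym set)"
  \<comment> \<open>By linearity it suffices to send each \<open>H \<pi>\<close> with
    \<open>\<pi>\<close> a matching into the subspace \<open>matching_span2\<close>, which lies in
    the tensor square.\<close>
  proof (rule order_trans[OF linear_image_span_subset matching_span2_subset])
    show "Vector_Spaces.linear scale scale (comul :: 'k parsym \<Rightarrow> 'k parsym2)"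
      using is_comul_comul unfolding is_comul_def by blast
  qed (rule free_vs.subspace_span, use comul_H_matching in blast)
  show "antipode ` matching_span \<subseteq> (matching_span :: 'k parsym set)"
  proof (rule linear_image_span_subset)
    show "Vector_Spaces.linear scale scale (antipode :: 'k parsym \<Rightarrow> 'k parsym)"
      using is_antipode_antipode unfolding is_antipode_def by blast
  qed (rule free_vs.subspace_span, use antipode_H_matching in blast)
qed (fact free_vs.subspace_span H_in_matching_span[OF matching_empty]
    | rule matching_span_mult; assumption)+

end
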